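(* Let $N\ge1$ be an integer. (1) For all $\alpha,\beta,\tau_0,\tau_1,\tau_2,\tau_3,\tau_4\in\mathbb C$, the operator $$W=\tau_1XY+\tau_2YX+\tau_3X+\tau_4Y+\tau_0\mathcal I ,$$ where $X$ is multiplication by $x$ and $Y$ is the Hahn difference operator with parameters $\alpha,\beta,N$, equals $A_1(x)T^{+}+A_2(x)T^{-}+A_0(x)\mathcal I$ with $$A_1(x)=(x-N)(x+\alpha+1)\bigl((\tau_1+\tau_2)x+\tau_2+\tau_4\bigr),$$ $$A_2(x)=x(x-\beta-N-1)\bigl((\tau_1+\tau_2)x+\tau_4-\tau_2\bigr),$$ $$A_0(x)=-A_1(x)-A_2(x)+\bigl((\alpha+\beta+2)\tau_2+\tau_3\bigr)x+\tau_0-N(\alpha+1)\tau_2 .$$ In particular $W$ is a Heun-Hahn operator, with $\kappa=\tau_1+\tau_2$. (2) Conversely, every Heun-Hahn operator with $\kappa\neq0$ is of the form $\tau_1XY+\tau_2YX+\tau_3X+\tau_4Y+\tau_0\mathcal I$ for some $\alpha,\beta,\tau_0,\dots,\tau_4\in\mathbb C$ (with $Y$ the Hahn difference operator with parameters $\alpha,\beta,N$).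
   Context: All operators act on functions (e.g. polynomials) of the variable $x$; $T^{\pm}f(x)=f(x\pm1)$, $\mathcal I$ is the identity, and $Xf(x)=xf(x)$. The Hahn difference operator with parameters $\alpha,\beta,N$ is $$Y=B(x)T^{+}+D(x)T^{-}-(B(x)+D(x))\mathcal I,\qquad B(x)=(x-N)(x+\alpha+1),\quad D(x)=x(x-\beta-N-1).$$ A Heun-Hahn operator is an operator $A_1(x)T^{+}+A_2(x)T^{-}+A_0(x)\mathcal I$ with $$A_1(x)=(x-N)(\kappa x^2+\mu_1x+\mu_0),\quad A_2(x)=x(\kappa x^2+\nu_1x+\nu_0),\quad A_0(x)=-A_1(x)-A_2(x)+r_1x+r_0$$ for some constants $\kappa,\mu_0,\mu_1,\nu_0,\nu_1,r_0,r_1\in\mathbb C$. *)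

theory Defs
  imports Complex_Main
begin

text \<open>
  Operators act on arbitrary functions \<open>complex \<Rightarrow> complex\<close>. An identity of operators on all such
  functions contains the same identity on polynomials.
\<close>

type_synonym operator = "(complex \<Rightarrow> complex) \<Rightarrow> (complex \<Rightarrow> complex)"

definition shift_plus :: operator where
  "shift_plus f = (\<lambda>x. f (x + 1))"

definition shift_minus :: operator where
  "shift_minus f = (\<lambda>x. f (x - 1))"

definition X_op :: operator where
  "X_op f = (\<lambda>x. x * f x)"

definition three_term_op ::
  "(complex \<Rightarrow> complex) \<Rightarrow> (complex \<Rightarrow> complex) \<Rightarrow> (complex \<Rightarrow> complex) \<Rightarrow> operator" where
  "three_term_op A1 A2 A0 f = (\<lambda>x. A1 x * shift_plus f x + A2 x * shift_minus f x + A0 x * f x)"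

definition hahn_B :: "complex \<Rightarrow> nat \<Rightarrow> complex \<Rightarrow> complex" where
  "hahn_B \<alpha> N x = (x - of_nat N) * (x + \<alpha> + 1)"

definition hahn_D :: "complex \<Rightarrow> nat \<Rightarrow> complex \<Rightarrow> complex" where
  "hahn_D \<beta> N x = x * (x - \<beta> - of_nat N - 1)"

definition hahn_op :: "complex \<Rightarrow> complex \<Rightarrow> nat \<Rightarrow> operator" where
  "hahn_op \<alpha> \<beta> N =
     three_term_op (hahn_B \<alpha> N) (hahn_D \<beta> N) (\<lambda>x. - (hahn_B \<alpha> N x + hahn_D \<beta> N x))"

definition bilinear_op :: "operator \<Rightarrow> operator \<Rightarrow>
    complex \<Rightarrow> complex \<Rightarrow> complex \<Rightarrow> complex \<Rightarrow> complex \<Rightarrow> operator" where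
  "bilinear_op X Y \<tau>0 \<tau>1 \<tau>2 \<tau>3 \<tau>4 f =
     (\<lambda>x. \<tau>1 * (X \<circ> Y) f x + \<tau>2 * (Y \<circ> X) f x + \<tau>3 * X f x + \<tau>4 * Y f x + \<tau>0 * f x)"

definition heun_hahn_op :: "nat \<Rightarrow> complex \<Rightarrow> operator \<Rightarrow> bool" where
  "heun_hahn_op N \<kappa> L \<longleftrightarrow>
     (\<exists>\<mu>0 \<mu>1 \<nu>0 \<nu>1 r0 r1.
        let A1 = (\<lambda>x. (x - of_nat N) * (\<kappa> * x\<^sup>2 + \<mu>1 * x + \<mu>0));
            A2 = (\<lambda>x. x * (\<kappa> * x\<^sup>2 + \<nu>1 * x + \<nu>0));
            A0 = (\<lambda>x. - A1 x - A2 x + r1 * x + r0)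
        in L = three_term_op A1 A2 A0)"

end

theory Submission imports Defs begin

text \<open>
  Since \<open>Y X f x = B x * (x + 1) * f (x + 1) + D x * (x - 1) * f (x - 1) - (B x + D x) * x * f x\<close>, the shift
  coefficients of \<open>W\<close> are \<open>B\<close> and \<open>D\<close> times linear factors with common leading coefficient
  \<open>\<tau>1 + \<tau>2\<close>, and the affine part of \<open>A0\<close> comes from \<open>B - D\<close>, whose quadratic terms cancel.
  Conversely, the two quadratics of a Heun-Hahn operator with \<open>\<kappa> \<noteq> 0\<close> split over the complex numbers;
  one root of each fixes \<open>\<alpha>\<close> and \<open>\<beta>\<close>, and the other roots give a linear system for the \<open>\<tau>\<close>'s.
\<close>

lemma bilinear_hahn_op_eq_three_term:
  "bilinear_op X_op (hahn_op \<alpha> \<beta> N) \<tau>0 \<tau>1 \<tau>2 \<tau>3 \<tau>4 =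
   three_term_op
     (\<lambda>x. (x - of_nat N) * (x + \<alpha> + 1) * ((\<tau>1 + \<tau>2) * x + \<tau>2 + \<tau>4))
     (\<lambda>x. x * (x - \<beta> - of_nat N - 1) * ((\<tau>1 + \<tau>2) * x + \<tau>4 - \<tau>2))
     (\<lambda>x. - ((x - of_nat N) * (x + \<alpha> + 1) * ((\<tau>1 + \<tau>2) * x + \<tau>2 + \<tau>4))
          - x * (x - \<beta> - of_nat N - 1) * ((\<tau>1 + \<tau>2) * x + \<tau>4 - \<tau>2)
          + ((\<alpha> + \<beta> + 2) * \<tau>2 + \<tau>3) * x + \<tau>0 - of_nat N * (\<alpha> + 1) * \<tau>2)"
  by (intro ext)
    (simp add: bilinear_op_def hahn_op_def three_term_op_def X_op_def hahn_B_def hahn_D_def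
      shift_plus_def shift_minus_def algebra_simps)

text \<open>The quadratic formula: \<open>csqrt\<close> supplies a square root of the discriminant,
  and the factorization follows from the root sum and product alone (Vieta).\<close>

lemma complex_quadratic_splits:
  fixes a b c :: complex
  assumes "a \<noteq> 0"
  obtains p q where "\<And>x. a * x\<^sup>2 + b * x + c = a * (x - p) * (x - q)"
proof -
  define z where "z = csqrt (b\<^sup>2 - 4 * a * c)"
  have z: "z * z = b * b - 4 * a * c"
    using power2_csqrt[of "b\<^sup>2 - 4 * a * c"] by (simp add: z_def power2_eq_square)
  define p q where "p = (z - b) / (2 * a)" and "q = (- z - b) / (2 * a)"
  have sum_roots: "a * (p + q) = - b"
    using assms by (simp add: p_def q_def field_simps)
  have "4 * a * (a * (p * q)) = b * b - z * z"
    using assms by (simp add: p_def q_def field_simps)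
  then have prod_roots: "a * (p * q) = c"
    using assms z by simp
  have "a * x\<^sup>2 + b * x + c = a * (x - p) * (x - q)" for x
    using sum_roots prod_roots by algebra
  then show ?thesis by (rule that)
qed

lemma bilinear_hahn_op_is_heun_hahn:
  "heun_hahn_op N (\<tau>1 + \<tau>2) (bilinear_op X_op (hahn_op \<alpha> \<beta> N) \<tau>0 \<tau>1 \<tau>2 \<tau>3 \<tau>4)"
  unfolding heun_hahn_op_def Let_def bilinear_hahn_op_eq_three_term
  \<comment> \<open>The witnesses, in the order \<open>\<mu>0\<close>, \<open>\<mu>1\<close>,
    \<open>\<nu>0\<close>, \<open>\<nu>1\<close>, \<open>r0\<close>, \<open>r1\<close>, are the
    coefficients read off after multiplying out the two linear factors in each shift
    coefficient.\<close>
  by (rule exI[of _ "(\<alpha> + 1) * (\<tau>2 + \<tau>4)"],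
      rule exI[of _ "\<tau>2 + \<tau>4 + (\<alpha> + 1) * (\<tau>1 + \<tau>2)"],
      rule exI[of _ "(\<beta> + of_nat N + 1) * (\<tau>2 - \<tau>4)"],
      rule exI[of _ "\<tau>4 - \<tau>2 - (\<beta> + of_nat N + 1) * (\<tau>1 + \<tau>2)"],
      rule exI[of _ "\<tau>0 - of_nat N * (\<alpha> + 1) * \<tau>2"],
      rule exI[of _ "(\<alpha> + \<beta> + 2) * \<tau>2 + \<tau>3"])
    (intro arg_cong3[where f = three_term_op] ext; simp add: power2_eq_square algebra_simps)

lemma heun_hahn_op_is_bilinear_hahn_op:
  assumes "\<kappa> \<noteq> 0" and "heun_hahn_op N \<kappa> L"
  shows "\<exists>\<alpha> \<beta> \<tau>0 \<tau>1 \<tau>2 \<tau>3 \<tau>4. L = bilinear_op X_op (hahn_op \<alpha> \<beta> N) \<tau>0 \<tau>1 \<tau>2 \<tau>3 \<tau>4"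
proof -
  obtain \<mu>0 \<mu>1 \<nu>0 \<nu>1 r0 r1 where L: "L = three_term_op
      (\<lambda>x. (x - of_nat N) * (\<kappa> * x\<^sup>2 + \<mu>1 * x + \<mu>0))
      (\<lambda>x. x * (\<kappa> * x\<^sup>2 + \<nu>1 * x + \<nu>0))
      (\<lambda>x. - ((x - of_nat N) * (\<kappa> * x\<^sup>2 + \<mu>1 * x + \<mu>0)) - x * (\<kappa> * x\<^sup>2 + \<nu>1 * x + \<nu>0)
           + r1 * x + r0)"
    using assms(2) unfolding heun_hahn_op_def Let_def by blast
  obtain p q where pq: "\<And>x. \<kappa> * x\<^sup>2 + \<mu>1 * x + \<mu>0 = \<kappa> * (x - p) * (x - q)"
    using complex_quadratic_splits[OF assms(1)] by blast
  obtain u v where uv: "\<And>x. \<kappa> * x\<^sup>2 + \<nu>1 * x + \<nu>0 = \<kappa> * (x - u) * (x - v)"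
    using complex_quadratic_splits[OF assms(1)] by blast
  \<comment> \<open>Chosen so that the Hahn factors become \<open>x - p\<close> and
    \<open>x - u\<close>.\<close>
  define \<alpha> \<beta> where "\<alpha> = - p - 1" and "\<beta> = u - of_nat N - 1"
  \<comment> \<open>The solution of \<open>\<tau>2 + \<tau>4 = - \<kappa> * q\<close> and
    \<open>\<tau>4 - \<tau>2 = - \<kappa> * v\<close>.\<close>
  define \<tau>2 \<tau>4 where "\<tau>2 = \<kappa> * (v - q) / 2" and "\<tau>4 = - \<kappa> * (v + q) / 2"
  have A1: "(x + \<alpha> + 1) * (\<kappa> * x + \<tau>2 + \<tau>4) = \<kappa> * (x - p) * (x - q)" for x
    by (simp add: \<alpha>_def \<tau>2_def \<tau>4_def field_simps)
  have A2: "(x - \<beta> - of_nat N - 1) * (\<kappa> * x + \<tau>4 - \<tau>2) = \<kappa> * (x - u) * (x - v)" for x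
    by (simp add: \<beta>_def \<tau>2_def \<tau>4_def field_simps)
  \<comment> \<open>Taking \<open>\<tau>1 = \<kappa> - \<tau>2\<close> gives the leading coefficient
    \<open>\<kappa>\<close>; the values of \<open>\<tau>0\<close> and \<open>\<tau>3\<close> cancel
    the \<open>\<tau>2\<close> terms in the affine part, leaving \<open>r1 * x + r0\<close>.\<close>
  have "L = bilinear_op X_op (hahn_op \<alpha> \<beta> N)
      (r0 + of_nat N * (\<alpha> + 1) * \<tau>2) (\<kappa> - \<tau>2) \<tau>2 (r1 - (\<alpha> + \<beta> + 2) * \<tau>2) \<tau>4"
    unfolding L bilinear_hahn_op_eq_three_term pq uv
    by (intro arg_cong3[where f = three_term_op] ext) (simp_all add: mult.assoc A1 A2)
  then show ?thesis by blast
qed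

theorem mainTheorem3:
  fixes N :: nat
  assumes "N \<ge> 1"
  shows
    "(\<forall>\<alpha> \<beta> \<tau>0 \<tau>1 \<tau>2 \<tau>3 \<tau>4 :: complex.
        let W = bilinear_op X_op (hahn_op \<alpha> \<beta> N) \<tau>0 \<tau>1 \<tau>2 \<tau>3 \<tau>4;
            A1 = (\<lambda>x. (x - of_nat N) * (x + \<alpha> + 1) * ((\<tau>1 + \<tau>2) * x + \<tau>2 + \<tau>4));
            A2 = (\<lambda>x. x * (x - \<beta> - of_nat N - 1) * ((\<tau>1 + \<tau>2) * x + \<tau>4 - \<tau>2));
            A0 = (\<lambda>x. - A1 x - A2 x + ((\<alpha> + \<beta> + 2) * \<tau>2 + \<tau>3) * x
                        + \<tau>0 - of_nat N * (\<alpha> + 1) * \<tau>2)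
        in W = three_term_op A1 A2 A0 \<and> heun_hahn_op N (\<tau>1 + \<tau>2) W)
     \<and> (\<forall>(\<kappa> :: complex) L. \<kappa> \<noteq> 0 \<longrightarrow> heun_hahn_op N \<kappa> L \<longrightarrow>
        (\<exists>\<alpha> \<beta> \<tau>0 \<tau>1 \<tau>2 \<tau>3 \<tau>4 :: complex.
           L = bilinear_op X_op (hahn_op \<alpha> \<beta> N) \<tau>0 \<tau>1 \<tau>2 \<tau>3 \<tau>4))"
  unfolding Let_def
  by (intro conjI allI impI bilinear_hahn_op_eq_three_term bilinear_hahn_op_is_heun_hahn
      heun_hahn_op_is_bilinear_hahn_op)

end
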